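(* Let $\lambda\in\mathbb{C}_p$ with $\lambda\ne0$ and $|\lambda|_p\le1$ ($p$ an odd prime). For every $n\ge0$, \[ \sum_{l=0}^n S_1(n,l)\,\mathcal{E}_{l,\lambda}(x)=Ch_{n,\lambda}(x). \]
   Context: $S_1(n,l)$ are the (signed) Stirling numbers of the first kind: $x(x-1)\cdots(x-n+1)=\sum_{l=0}^nS_1(n,l)x^l$. Write $(x)_{0,\lambda}=1$, $(x)_{n,\lambda}=x(x-\lambda)\cdots(x-(n-1)\lambda)$, and $(1+\lambda u)^{x/\lambda}=\sum_{m\ge0}(x)_{m,\lambda}u^m/m!$. Carlitz's degenerate Euler polynomials are defined by $\frac{2}{(1+\lambda t)^{1/\lambda}+1}(1+\lambda t)^{x/\lambda}=\sum_{n\ge0}\mathcal{E}_{n,\lambda}(x)\frac{t^n}{n!}$. The degenerate Changhee polynomials of the second kind are defined by $\frac{2}{1+(1+\lambda\log(1+t))^{1/\lambda}}(1+\lambda\log(1+t))^{x/\lambda}=\sum_{n\ge0}Ch_{n,\lambda}(x)\frac{t^n}{n!}$. *)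

theory Defs
  imports "HOL-Analysis.Analysis" "HOL-Computational_Algebra.Computational_Algebra"
begin

section \<open>The field of $p$-adic complex numbers\<close>

locale ultrametric_field =
  fixes v :: "'a :: field_char_0 \<Rightarrow> real"
  assumes v_nonneg: "0 \<le> v x"
    and v_eq_0_iff: "v x = 0 \<longleftrightarrow> x = 0"
    and v_mult: "v (x * y) = v x * v y"
    and v_add: "v (x + y) \<le> max (v x) (v y)"
begin

lemma v_one: "v 1 = 1"
  using v_mult[of 1 1] v_eq_0_iff[of 1] by simp

lemma v_minus: "v (- x) = v x"
proof -
  have "v (- 1) * v (- 1) = 1"
    using v_mult[of "- 1" "- 1"] v_one by simp
  hence "v (- 1) = 1"
    using v_nonneg[of "- 1"] by (simp add: square_eq_1_iff)
  thus ?thesis using v_mult[of "- 1" x] by simp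
qed

sublocale Metric_space UNIV "\<lambda>x y. v (x - y)"
proof
  fix x y z :: 'a
  show "0 \<le> v (x - y)" by (rule v_nonneg)
  show "v (x - y) = v (y - x)" using v_minus[of "x - y"] by simp
  show "v (x - y) = 0 \<longleftrightarrow> x = y" by (simp add: v_eq_0_iff)
  show "v (x - z) \<le> v (x - y) + v (y - z)"
    using v_add[of "x - y" "y - z"] v_nonneg[of "x - y"] v_nonneg[of "y - z"] by simp
qed

text \<open>When the field is complete and \<open>v p = 1 / p\<close>, the closure of the rational numbers is the
  completion of the rationals for the $p$-adic absolute value, i.e. the field of $p$-adic
  numbers.\<close>

definition Qp :: "'a set" where
  "Qp = mtopology closure_of \<rat>"

definition Qp_bar :: "'a set" where
  "Qp_bar = {x. \<exists>f. f \<noteq> 0 \<and> (\<forall>i. coeff f i \<in> Qp) \<and> poly f x = 0}"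

end

text \<open>The field \<open>'a\<close> with the absolute value \<open>v\<close> is \<open>\<complex>\<^sub>p\<close>, the completion of an algebraic closure
  of the $p$-adic numbers, with the absolute value normalized by \<open>v p = 1 / p\<close>. These conditions
  determine the field up to isometric isomorphism.\<close>

locale padic_complex_field = ultrametric_field v for v :: "'a :: field_char_0 \<Rightarrow> real" +
  fixes p :: nat
  assumes prime_p: "prime p"
    and v_p: "v (of_nat p) = 1 / real p"
    and Qp_bar_alg_closed:
      "\<lbrakk>degree f > 0; \<forall>i. coeff f i \<in> Qp_bar\<rbrakk> \<Longrightarrow> \<exists>x\<in>Qp_bar. poly f x = 0"
    and Qp_bar_dense: "mtopology closure_of Qp_bar = UNIV"
    and complete: "mcomplete"


section \<open>Stirling numbers of the first kind and degenerate polynomials\<close>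

text \<open>Signed, in contrast to the \<open>stirling\<close> of \<open>HOL-Combinatorics\<close>.\<close>

definition S1 :: "nat \<Rightarrow> nat \<Rightarrow> int" where
  "S1 n l = coeff (\<Prod>i<n. [:- int i, 1:]) l"

definition degen_ff :: "'a :: comm_ring_1 \<Rightarrow> 'a \<Rightarrow> nat \<Rightarrow> 'a" where
  "degen_ff lam x n = (\<Prod>i<n. x - of_nat i * lam)"

text \<open>\<open>degen_pow lam c\<close> is the series \<open>(1 + lam u)\<^bsup>c/lam\<^esup>\<close> in the variable \<open>u\<close>, for a scalar \<open>c\<close>;
  \<open>degen_pow_X lam\<close> is the series \<open>(1 + lam u)\<^bsup>x/lam\<^esup>\<close> for the polynomial indeterminate
  \<open>x = [:0, 1:]\<close>, whose coefficients are polynomials in \<open>x\<close>.\<close>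

definition degen_pow :: "'a :: field_char_0 \<Rightarrow> 'a \<Rightarrow> 'a fps" where
  "degen_pow lam c = Abs_fps (\<lambda>m. degen_ff lam c m / fact m)"

definition degen_pow_X :: "'a :: field_char_0 \<Rightarrow> 'a poly fps" where
  "degen_pow_X lam = Abs_fps (\<lambda>m. smult (1 / fact m) (degen_ff [:lam:] [:0, 1:] m))"

definition fps_lift :: "'a :: field_char_0 fps \<Rightarrow> 'a poly fps" where
  "fps_lift f = Abs_fps (\<lambda>n. [:fps_nth f n:])"

text \<open>In \<open>Ch_gf\<close>, \<^term>\<open>fps_ln 1\<close> is the series \<open>log (1 + t)\<close>.\<close>

definition Euler_gf :: "'a :: field_char_0 \<Rightarrow> 'a poly fps" where
  "Euler_gf lam = fps_lift (2 / (degen_pow lam 1 + 1)) * degen_pow_X lam"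

definition degen_Euler :: "nat \<Rightarrow> 'a :: field_char_0 \<Rightarrow> 'a poly" where
  "degen_Euler n lam = smult (fact n) (fps_nth (Euler_gf lam) n)"

definition Ch_gf :: "'a :: field_char_0 \<Rightarrow> 'a poly fps" where
  "Ch_gf lam = fps_lift (2 / (1 + (degen_pow lam 1 oo fps_ln 1)))
               * (degen_pow_X lam oo fps_lift (fps_ln 1))"

definition degen_Ch :: "nat \<Rightarrow> 'a :: field_char_0 \<Rightarrow> 'a poly" where
  "degen_Ch n lam = smult (fact n) (fps_nth (Ch_gf lam) n)"

text \<open>Evaluated at a scalar \<open>c\<close>, the polynomials have the expected generating functions.\<close>

lemma fps_lift_power: "fps_lift f ^ n = fps_lift (f ^ n)"
proof (induction n)
  case 0
  show ?case by (auto simp: fps_eq_iff fps_lift_def fps_one_nth)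
next
  case (Suc n)
  have "fps_lift (g * h) = fps_lift g * fps_lift h" for g h :: "'a fps"
    by (rule fps_ext, rule poly_eqI)
      (simp add: fps_lift_def fps_mult_nth coeff_sum coeff_pCons mult.commute split: nat.splits)
  thus ?case by (simp add: Suc)
qed

lemma poly_degen_ff: "poly (degen_ff [:lam:] [:0, 1:] n) c = degen_ff lam c n"
  by (simp add: degen_ff_def poly_prod mult.commute)

lemma poly_degen_pow_X: "poly (fps_nth (degen_pow_X lam) n) c = fps_nth (degen_pow lam c) n"
  by (simp add: degen_pow_X_def degen_pow_def poly_degen_ff)

lemma degen_Euler_genfun:
  "Abs_fps (\<lambda>n. poly (degen_Euler n lam) c / fact n) = 2 / (degen_pow lam 1 + 1) * degen_pow lam c"
  by (rule fps_ext)
    (simp add: degen_Euler_def Euler_gf_def fps_mult_nth poly_sum poly_degen_pow_X fps_lift_def)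

lemma degen_Ch_genfun:
  "Abs_fps (\<lambda>n. poly (degen_Ch n lam) c / fact n) =
     2 / (1 + (degen_pow lam 1 oo fps_ln 1)) * (degen_pow lam c oo fps_ln 1)"
proof -
  have "poly (fps_nth (degen_pow_X lam oo fps_lift (fps_ln 1)) n) c =
      fps_nth (degen_pow lam c oo fps_ln 1) n" for n
    by (simp add: fps_compose_nth fps_lift_power poly_sum poly_degen_pow_X)
      (simp add: fps_lift_def)
  thus ?thesis
    by (intro fps_ext)
      (simp add: degen_Ch_def Ch_gf_def fps_mult_nth poly_sum,
       simp add: fps_lift_def)
qed

end

theory Submission
  imports Defs
begin

text \<open>Both generating functions are related by \<open>Ch(t) = Euler(log (1 + t))\<close>. The claim follows by
  comparing coefficients, since \<open>(log (1 + t))\<^sup>l\<close> is \<open>l!\<close> times the exponential generating function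
  of \<open>n \<mapsto> S1 n l\<close>.\<close>

lemma S1_0_right: "S1 n 0 = (if n = 0 then 1 else 0)"
  by (auto simp: S1_def coeff_0_power prod.lessThan_Suc_shift gr0_conv_Suc
      simp flip: poly_0_coeff_0 simp: poly_prod)

lemma S1_0_left: "S1 0 l = (if l = 0 then 1 else 0)"
  by (simp add: S1_def)

lemma S1_Suc_Suc: "S1 (Suc n) (Suc l) = S1 n l - int n * S1 n (Suc l)"
  by (simp add: S1_def)

text \<open>Both sides satisfy the recurrence \<open>S1_Suc_Suc\<close>, by
  \<open>(1 + t) (L\<^bsup>l+1\<^esup>)' = (l + 1) L\<^sup>l\<close> for \<open>L = log (1 + t)\<close>.\<close>

lemma fps_ln_1_power_nth:
  "fps_nth (fps_ln (1 :: 'a :: field_char_0) ^ l) n = of_int (S1 n l) * fact l / fact n"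
proof (induction n arbitrary: l)
  case 0
  show ?case by (cases l) (simp_all add: S1_0_left)
next
  case (Suc n)
  show ?case
  proof (cases l)
    case 0
    then show ?thesis by (simp add: S1_0_right)
  next
    case (Suc k)
    let ?L = "fps_ln (1 :: 'a)"
    have "(1 + fps_X) * fps_deriv ?L = 1"
      by (simp add: fps_ln_deriv mult.commute[of "1 + fps_X"] inverse_mult_eq_1)
    moreover have "(1 + fps_X) * fps_deriv (?L ^ Suc k)
        = ((1 + fps_X) * fps_deriv ?L) * (of_nat (Suc k) * ?L ^ k)"
      by (simp only: fps_deriv_power' diff_Suc_1 mult_ac)
    ultimately have "(1 + fps_X) * fps_deriv (?L ^ Suc k) = of_nat (Suc k) * ?L ^ k"
      by (simp only: mult_1)
    then have "fps_nth ((1 + fps_X) * fps_deriv (?L ^ Suc k)) n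
        = fps_nth (of_nat (Suc k) * ?L ^ k) n"
      by simp
    \<comment> \<open>The case split on \<open>n\<close> handles the shift by \<open>fps_X\<close>:
      at \<open>n = 0\<close> its contribution is 0, which the factor \<open>of_nat n\<close>
      reproduces.\<close>
    then have "of_nat (Suc n) * fps_nth (?L ^ Suc k) (Suc n)
        + of_nat n * fps_nth (?L ^ Suc k) n = of_nat (Suc k) * fps_nth (?L ^ k) n"
      by (cases n) (simp_all add: distrib_right fps_of_nat[symmetric] del: of_nat_Suc power_Suc)
    \<comment> \<open>The induction hypothesis enters at both exponents \<open>k\<close> and
      \<open>Suc k\<close>, hence the arbitrary \<open>l\<close>.\<close>
    then have "of_nat (Suc n) * fps_nth (?L ^ Suc k) (Suc n)
        = of_int (S1 (Suc n) (Suc k)) * fact (Suc k) / fact n"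
      unfolding Suc.IH S1_Suc_Suc
      by (simp add: eq_diff_eq[symmetric] diff_divide_distrib left_diff_distrib right_diff_distrib mult_ac
          del: power_Suc of_nat_Suc)
    then show ?thesis
      unfolding Suc fact_Suc[of n]
      by (simp add: nonzero_eq_divide_eq mult_ac del: power_Suc of_nat_Suc fact_Suc)
  qed
qed

lemma fps_compose_ln_1_nth:
  fixes f :: "'a :: field_char_0 fps"
  shows "fact n * fps_nth (f oo fps_ln 1) n
    = (\<Sum>l=0..n. of_int (S1 n l) * (fact l * fps_nth f l))"
  by (simp add: fps_compose_nth fps_ln_1_power_nth sum_distrib_left mult_ac)

lemma degen_Ch_genfun_eq_compose:
  "Abs_fps (\<lambda>n. poly (degen_Ch n lam) c / fact n)
    = Abs_fps (\<lambda>n. poly (degen_Euler n lam) c / fact n) oo fps_ln 1"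
proof -
  \<comment> \<open>The constant term is 2, so the denominator is a unit and its inverse commutes
    with substituting \<open>fps_ln 1\<close>, which has constant term 0.\<close>
  have "fps_nth (degen_pow lam 1 + 1) 0 \<noteq> 0"
    by (simp add: degen_pow_def degen_ff_def)
  then show ?thesis
    by (simp add: degen_Ch_genfun degen_Euler_genfun fps_compose_mult_distrib
        fps_divide_compose fps_compose_add_distrib add.commute fps_divide_unit fps_inverse_compose)
qed

theorem theorem2p2:
  fixes absv :: "'a :: field_char_0 \<Rightarrow> real" and p n :: nat and lam :: 'a
  assumes Cp: "padic_complex_field absv p"
    and p_odd: "odd p"
    and lambda_nonzero: "lam \<noteq> 0"
    and lambda_le_1: "absv lam \<le> 1"
  shows "(\<Sum>l=0..n. smult (of_int (S1 n l)) (degen_Euler l lam)) = degen_Ch n lam"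
proof -
  \<comment> \<open>Evaluating at scalars suffices: over an infinite field, a polynomial is
    determined by its values.\<close>
  have "poly (\<Sum>l=0..n. smult (of_int (S1 n l)) (degen_Euler l lam)) c = poly (degen_Ch n lam) c" for c
    using fps_compose_ln_1_nth[of n "Abs_fps (\<lambda>n. poly (degen_Euler n lam) c / fact n)"]
    by (simp add: poly_sum flip: degen_Ch_genfun_eq_compose)
  then show ?thesis
    by (auto simp flip: poly_eq_poly_eq_iff)
qed

end
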